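(* Let $T>0$, let $B^H=(B^H_t)_{t\in[0,T]}$ be fractional Brownian motion with Hurst parameter $H\in(0,\tfrac12)$, and let $$F=f(B^H_{t_1},\dots,B^H_{t_n}),\qquad f\in C^1_b(\mathbb R^n),\qquad 0\le t_1<\cdots<t_n\le T.$$ Then $$D_{B^H}F=\sum_{i=1}^n\partial_if(B^H_{t_1},\dots,B^H_{t_n})\,k_{t_i},$$ where $k_{t_i}\in\mathcal H_H$ is the evaluation representer at time $t_i$.
   Context: Fractional Brownian motion $B^H$ on a complete probability space $(\Omega,\mathcal F,\mathbb P)$ is the centered Gaussian process with covariance $R_H(t,s)=\mathbb E[B^H_tB^H_s]=\frac12(t^{2H}+s^{2H}-|t-s|^{2H})$. $C_b^k(\mathbb R^n)$ denotes the $k$-times continuously differentiable functions $\mathbb R^n\to\mathbb R$ with bounded derivatives up to order $k$. Cameron–Martin space: $\mathcal H_H$ is the reproducing kernel Hilbert space of $R_H$, i.e. the completion of $\mathrm{span}\{R_H(t,\cdot):t\in[0,T]\}$ under $\langle R_H(t,\cdot),R_H(s,\cdot)\rangle_{\mathcal H_H}=R_H(t,s)$. The evaluation representer is $k_t:=R_H(t,\cdot)$, so $\langle h,k_t\rangle_{\mathcal H_H}=h(t)$ for $h\in\mathcal H_H$. Skorokhod integral and operator-covariant derivative: for smooth cylindrical $G=g(B^H_{s_1},\dots,B^H_{s_m})$ with $g\in C_b^\infty(\mathbb R^m)$, the Malliavin derivative is $DG=\sum_j\partial_jg(B^H_{s_1},\dots,B^H_{s_m})\,k_{s_j}\in L^2(\Omega;\mathcal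 H_H)$. The Skorokhod integral $\delta_H$, with domain $\mathrm{Dom}(\delta_H)\subset L^2(\Omega;\mathcal H_H)$, is the adjoint of $D$: $\mathbb E[G\,\delta_H(u)]=\mathbb E[\langle DG,u\rangle_{\mathcal H_H}]$. For $F\in L^2(\Omega)$, the operator-covariant derivative $D_{B^H}F\in L^2(\Omega;\mathcal H_H)$ (when it exists) is the adjoint of $\delta_H$ applied to $F$, i.e. the element with $\mathbb E[F\,\delta_H(u)]=\mathbb E[\langle D_{B^H}F,u\rangle_{\mathcal H_H}]$ for all $u\in\mathrm{Dom}(\delta_H)$. *)

theory Defs
  imports "HOL-Probability.Probability"
begin

(* A function on R^n is modelled as a function of x :: nat => real that depends only on
   x 0, ..., x (n - 1), so that n can be quantified over inside a formula.  For such a function,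
   continuity in the product topology on nat => real is continuity on R^n. *)

definition depends_on_first :: "nat \<Rightarrow> ((nat \<Rightarrow> real) \<Rightarrow> real) \<Rightarrow> bool" where
  "depends_on_first n f \<longleftrightarrow> (\<forall>x y. (\<forall>i<n. x i = y i) \<longrightarrow> f x = f y)"

definition partial_deriv :: "nat \<Rightarrow> ((nat \<Rightarrow> real) \<Rightarrow> real) \<Rightarrow> (nat \<Rightarrow> real) \<Rightarrow> real" where
  "partial_deriv i f x = deriv (\<lambda>y. f (x(i := y))) (x i)"

(* C_b^k(R^n): all iterated partial derivatives of order at most k, including f itself as the one
   of order 0, exist and are continuous and bounded. *)

fun Cb :: "nat \<Rightarrow> nat \<Rightarrow> ((nat \<Rightarrow> real) \<Rightarrow> real) \<Rightarrow> bool" where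
  "Cb n 0 f \<longleftrightarrow> depends_on_first n f \<and> continuous_on UNIV f \<and> bounded (range f)"
| "Cb n (Suc k) f \<longleftrightarrow> Cb n 0 f \<and>
     (\<forall>i<n. (\<forall>x. (\<lambda>y. f (x(i := y))) differentiable (at (x i))) \<and> Cb n k (partial_deriv i f))"

definition Cb_infinity :: "nat \<Rightarrow> ((nat \<Rightarrow> real) \<Rightarrow> real) \<Rightarrow> bool" where
  "Cb_infinity n f \<longleftrightarrow> (\<forall>k. Cb n k f)"

(* Constants count as (degenerate) Gaussian variables; B_0 = 0 is one. *)

definition gaussian_rv :: "'w measure \<Rightarrow> ('w \<Rightarrow> real) \<Rightarrow> bool" where
  "gaussian_rv M X \<longleftrightarrow> X \<in> borel_measurable M \<and>
     (\<exists>\<mu> \<sigma>. distr M borel X = return borel \<mu> \<or>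
            \<sigma> > 0 \<and> distributed M lborel X (normal_density \<mu> \<sigma>))"

definition gaussian_process :: "'w measure \<Rightarrow> real set \<Rightarrow> (real \<Rightarrow> 'w \<Rightarrow> real) \<Rightarrow> bool" where
  "gaussian_process M I X \<longleftrightarrow>
     (\<forall>J c. finite J \<and> J \<subseteq> I \<longrightarrow> gaussian_rv M (\<lambda>\<omega>. \<Sum>t\<in>J. c t * X t \<omega>))"

definition fbm_cov :: "real \<Rightarrow> real \<Rightarrow> real \<Rightarrow> real" where
  "fbm_cov H t s = (t powr (2 * H) + s powr (2 * H) - \<bar>t - s\<bar> powr (2 * H)) / 2"

definition fractional_brownian_motion ::
    "'w measure \<Rightarrow> real \<Rightarrow> real \<Rightarrow> (real \<Rightarrow> 'w \<Rightarrow> real) \<Rightarrow> bool" where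
  "fractional_brownian_motion M H T B \<longleftrightarrow>
     gaussian_process M {0..T} B \<and>
     (\<forall>t\<in>{0..T}. (LINT \<omega>|M. B t \<omega>) = 0) \<and>
     (\<forall>t\<in>{0..T}. \<forall>s\<in>{0..T}. (LINT \<omega>|M. B t \<omega> * B s \<omega>) = fbm_cov H t s)"

(* The Hilbert space 'h is the reproducing kernel Hilbert space of R on I.  An element h is
   regarded as the function val h on I, and k t is the element whose function is R(t,.).
   The first two clauses give <k s, k t> = R(s,t); with the density of the span and the
   completeness of 'h, this makes 'h the completion of span {R(t,.) | t in I}.  Density and the
   reproducing property also make h determined by the values of val h on I.
   The sort second_countable_topology, used for measurability of 'h-valued functions, costs
   nothing for a continuous kernel on an interval, because its RKHS is separable. *)

definition is_rkhs ::
    "real set \<Rightarrow> (real \<Rightarrow> real \<Rightarrow> real) \<Rightarrow>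
     ('h::{real_inner,banach,second_countable_topology} \<Rightarrow> real \<Rightarrow> real) \<Rightarrow> (real \<Rightarrow> 'h) \<Rightarrow> bool" where
  "is_rkhs I R val k \<longleftrightarrow>
     (\<forall>t\<in>I. \<forall>s\<in>I. val (k t) s = R t s) \<and>
     (\<forall>h. \<forall>t\<in>I. inner h (k t) = val h t) \<and>
     closure (span (k ` I)) = UNIV"

(* Representatives are used instead of a.e. classes. *)

definition L2 :: "'w measure \<Rightarrow> ('w \<Rightarrow> 'b::real_normed_vector) set" where
  "L2 M = {u \<in> borel_measurable M. integrable M (\<lambda>\<omega>. (norm (u \<omega>))\<^sup>2)}"

definition cylindrical ::
    "(real \<Rightarrow> 'w \<Rightarrow> real) \<Rightarrow> (nat \<Rightarrow> real) \<Rightarrow> ((nat \<Rightarrow> real) \<Rightarrow> real) \<Rightarrow> 'w \<Rightarrow> real" where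
  "cylindrical B s g \<omega> = g (\<lambda>j. B (s j) \<omega>)"

definition malliavin_deriv ::
    "(real \<Rightarrow> 'w \<Rightarrow> real) \<Rightarrow> (real \<Rightarrow> 'h::real_vector) \<Rightarrow> nat \<Rightarrow> (nat \<Rightarrow> real) \<Rightarrow>
     ((nat \<Rightarrow> real) \<Rightarrow> real) \<Rightarrow> 'w \<Rightarrow> 'h" where
  "malliavin_deriv B k m s g \<omega> =
     (\<Sum>j<m. cylindrical B s (partial_deriv j g) \<omega> *\<^sub>R k (s j))"

(* (u, V) lies in the graph of the Skorokhod integral, the adjoint of the Malliavin derivative on
   smooth cylindrical variables: u is in Dom and V is (a version of) its integral.  The integrals
   V, V' of one u may differ by an element of L2 orthogonal to all smooth cylindrical variables
   if the sigma-algebra of M is larger than the one generated by B. *)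

definition has_skorokhod_integral ::
    "'w measure \<Rightarrow> real \<Rightarrow> (real \<Rightarrow> 'w \<Rightarrow> real) \<Rightarrow>
     (real \<Rightarrow> 'h::{real_inner,banach,second_countable_topology}) \<Rightarrow>
     ('w \<Rightarrow> 'h) \<Rightarrow> ('w \<Rightarrow> real) \<Rightarrow> bool" where
  "has_skorokhod_integral M T B k u V \<longleftrightarrow>
     u \<in> L2 M \<and> V \<in> L2 M \<and>
     (\<forall>m s g. (\<forall>j<m. s j \<in> {0..T}) \<and> Cb_infinity m g \<longrightarrow>
        (LINT \<omega>|M. cylindrical B s g \<omega> * V \<omega>) =
        (LINT \<omega>|M. inner (malliavin_deriv B k m s g \<omega>) (u \<omega>)))"

(* (F, Y) lies in the graph of the adjoint of the Skorokhod integral. *)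

definition has_op_cov_deriv ::
    "'w measure \<Rightarrow> real \<Rightarrow> (real \<Rightarrow> 'w \<Rightarrow> real) \<Rightarrow>
     (real \<Rightarrow> 'h::{real_inner,banach,second_countable_topology}) \<Rightarrow>
     ('w \<Rightarrow> real) \<Rightarrow> ('w \<Rightarrow> 'h) \<Rightarrow> bool" where
  "has_op_cov_deriv M T B k F Y \<longleftrightarrow>
     F \<in> L2 M \<and> Y \<in> L2 M \<and>
     (\<forall>u V. has_skorokhod_integral M T B k u V \<longrightarrow>
        (LINT \<omega>|M. F \<omega> * V \<omega>) = (LINT \<omega>|M. inner (Y \<omega>) (u \<omega>)))"

end

theory Submission
  imports Defs
begin

text \<open>
  For smooth \<open>f\<close> the identity is the defining adjointness of the Skorokhod integral, so it suffices to
  approximate \<open>f\<close> in \<open>C_b^1\<close> by functions in \<open>C_b^\<infinity>\<close>, boundedly and pointwise together with the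
  first partial derivatives, and to pass to the limit by dominated convergence. The approximation
  convolves \<open>f\<close> with a rapidly decaying kernel in one coordinate after the other. The kernels
  \<open>p(tanh y) (1 - tanh\<^sup>2 y)\<close>, \<open>p\<close> a polynomial, are convenient for this: the class is closed under
  differentiation, and \<open>1 - tanh\<^sup>2\<close> has the bounded primitive \<open>tanh\<close> and changes under shifts by at
  most a constant factor.
\<close>

section \<open>Differentiation under the integral sign\<close>

text \<open>Along any sequence tending to \<open>a\<close>, the mean value inequality bounds the
  difference quotients by \<open>w\<close>, so dominated convergence applies. A bound near
  \<open>a\<close> is enough, which matters for a kernel whose shifts are comparable only
  locally.\<close>

lemma has_real_derivative_integral:
  fixes \<phi> \<phi>' :: "real \<Rightarrow> 'a \<Rightarrow> real"
  assumes int: "\<And>a. integrable M (\<phi> a)"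
    and meas: "\<phi>' a \<in> borel_measurable M"
    and deriv: "\<And>b z. ((\<lambda>b. \<phi> b z) has_real_derivative \<phi>' b z) (at b)"
    and "r > 0"
    and bound: "\<And>b z. \<bar>b - a\<bar> < r \<Longrightarrow> \<bar>\<phi>' b z\<bar> \<le> w z"
    and w: "integrable M w"
  shows "((\<lambda>b. LINT z|M. \<phi> b z) has_real_derivative (LINT z|M. \<phi>' a z)) (at a)"
  unfolding has_field_derivative_iff tendsto_at_iff_sequentially
proof (intro allI impI)
  fix X :: "nat \<Rightarrow> real"
  assume X: "\<forall>i. X i \<in> UNIV - {a}" "X \<longlonglongrightarrow> a"
  \<comment> \<open>Only from index \<open>N\<close> on do the points lie where \<open>w\<close>
    dominates. The sequence is therefore shifted by \<open>N\<close>, and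
    \<open>LIMSEQ_offset\<close> undoes the shift at the end.\<close>
  then obtain N where N: "\<And>i. i \<ge> N \<Longrightarrow> \<bar>X i - a\<bar> < r"
    using \<open>r > 0\<close> by (force simp: lim_sequentially dist_real_def)
  let ?q = "\<lambda>i z. (\<phi> (X i) z - \<phi> a z) / (X i - a)"
  have "(\<lambda>i. LINT z|M. ?q (i + N) z) \<longlonglongrightarrow> (LINT z|M. \<phi>' a z)"
  proof (rule integral_dominated_convergence[OF meas _ w])
    show "?q (i + N) \<in> borel_measurable M" for i
      using int by (intro borel_measurable_divide borel_measurable_diff) auto
    have "(\<lambda>i. ?q i z) \<longlonglongrightarrow> \<phi>' a z" for z
      using deriv[of z a] X by (auto simp: has_field_derivative_iff tendsto_at_iff_sequentially o_def)
    then show "AE z in M. (\<lambda>i. ?q (i + N) z) \<longlonglongrightarrow> \<phi>' a z"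
      using LIMSEQ_ignore_initial_segment[of "\<lambda>i. ?q i z" for z] by (intro AE_I2) blast
    have "\<bar>?q (i + N) z\<bar> \<le> w z" for i z
    proof -
      let ?S = "{a - r<..<a + r}"
      have S: "X (i + N) \<in> ?S" "a \<in> ?S"
        using N[of "i + N"] \<open>r > 0\<close> by (auto simp: abs_less_iff)
      have "norm (\<phi> (X (i + N)) z - \<phi> a z) \<le> w z * norm (X (i + N) - a)"
      proof (rule field_differentiable_bound[where S="?S" and f' = "\<lambda>b. \<phi>' b z", OF _ _ _ S(1) S(2)])
        show "((\<lambda>b. \<phi> b z) has_field_derivative \<phi>' b z) (at b within ?S)" for b
          by (rule has_field_derivative_at_within[OF deriv])
        show "norm (\<phi>' b z) \<le> w z" if "b \<in> ?S" for b
          using that bound[of b z] by (auto simp: abs_less_iff)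
      qed (rule convex_real_interval)
      moreover have "X (i + N) \<noteq> a" using X by blast
      ultimately show ?thesis by (simp add: abs_divide divide_le_eq)
    qed
    then show "AE z in M. norm (?q (i + N) z) \<le> w z" for i by simp
  qed
  also have "(\<lambda>i. LINT z|M. ?q (i + N) z) =
      (\<lambda>i. ((LINT z|M. \<phi> (X (i + N)) z) - (LINT z|M. \<phi> a z)) / (X (i + N) - a))"
    using int by simp
  finally have "(\<lambda>i. ((LINT z|M. \<phi> (X (i + N)) z) - (LINT z|M. \<phi> a z)) / (X (i + N) - a))
      \<longlonglongrightarrow> (LINT z|M. \<phi>' a z)" .
  then show "((\<lambda>b. ((LINT z|M. \<phi> b z) - (LINT z|M. \<phi> a z)) / (b - a)) \<circ> X) \<longlonglongrightarrow> (LINT z|M. \<phi>' a z)"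
    unfolding o_def by (rule LIMSEQ_offset)
qed

subsection \<open>Kernels\<close>

text \<open>The derivative of \<open>tanh\<close>, written through \<open>tanh\<close> so that
  products with polynomials in \<open>tanh\<close> differentiate to functions of the same
  form.\<close>

definition sech2 :: "real \<Rightarrow> real" where
  "sech2 y = 1 - tanh y ^ 2"

lemma sech2_eq: "sech2 y = 1 / cosh y ^ 2"
  by (simp add: sech2_def tanh_def power_divide cosh_square_eq divide_simps add_nonneg_eq_0_iff)

lemma sech2_pos: "sech2 y > 0"
  by (simp add: sech2_eq)

text \<open>A shift by \<open>h\<close> changes \<open>exp y\<close> and \<open>exp (-y)\<close>,
  hence \<open>cosh y\<close>, by a factor of at most \<open>exp \<bar>h\<bar>\<close>; squaring
  doubles the exponent. This provides one integrable majorant for all small shifts of a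
  kernel.\<close>

lemma sech2_shift: "sech2 (y + h) \<le> exp (2 * \<bar>h\<bar>) * sech2 y"
proof -
  have "exp y \<le> exp \<bar>h\<bar> * exp (y + h)" "exp (-y) \<le> exp \<bar>h\<bar> * exp (- (y + h))"
    by (simp_all flip: exp_add)
  then have "cosh y \<le> exp \<bar>h\<bar> * cosh (y + h)"
    by (simp add: cosh_def algebra_simps)
  then have "cosh y ^ 2 \<le> (exp \<bar>h\<bar> * cosh (y + h)) ^ 2"
    by (intro power_mono) auto
  also have "\<dots> = exp (2 * \<bar>h\<bar>) * cosh (y + h) ^ 2"
    by (simp add: power_mult_distrib exp_double)
  finally show ?thesis
    by (simp add: sech2_eq divide_simps)
qed

text \<open>Fundamental theorem of calculus on the whole line: the primitive \<open>tanh\<close>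
  rises from -1 to 1. The value 2 explains the polynomial \<open>[:1/2:]\<close> used later.\<close>

lemma
  shows integrable_sech2: "integrable lborel sech2"
    and integral_sech2: "(LINT y|lborel. sech2 y) = 2"
proof -
  have A: "((tanh \<circ> real_of_ereal) \<longlongrightarrow> -1) (at_right (-\<infinity>))"
    and B: "((tanh \<circ> real_of_ereal) \<longlongrightarrow> 1) (at_left \<infinity>)"
    using tanh_real_at_bot tanh_real_at_top by (simp_all add: ereal_tendsto_simps)
  have deriv: "(tanh has_real_derivative sech2 x) (at x)" and cont: "isCont sech2 x" for x
    unfolding sech2_def by (auto intro!: derivative_eq_intros continuous_intros)
  have nonneg: "AE x in lborel. - \<infinity> < ereal x \<longrightarrow> ereal x < \<infinity> \<longrightarrow> 0 \<le> sech2 x"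
    using sech2_pos by (auto simp: less_imp_le)
  have *: "set_integrable lborel (einterval (-\<infinity>) \<infinity>) sech2" "(LBINT y=-\<infinity>..\<infinity>. sech2 y) = 1 - (-1)"
    using interval_integral_FTC_nonneg[OF _ deriv cont nonneg A B] by simp_all
  show "integrable lborel sech2"
    using *(1) by (simp add: set_integrable_def)
  show "(LINT y|lborel. sech2 y) = 2"
    using *(2) by (simp add: interval_lebesgue_integral_def set_lebesgue_integral_def)
qed

definition tanh_kernel :: "real poly \<Rightarrow> real \<Rightarrow> real" where
  "tanh_kernel p y = poly p (tanh y) * sech2 y"

text \<open>Product rule in u = \<open>tanh y\<close>: the derivative of u is 1 - u*u, which is
  \<open>[:1, 0, -1:]\<close>, and that of \<open>sech2\<close> is -2 u \<open>sech2\<close>. One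
  factor \<open>sech2\<close> is split off.\<close>

definition tanh_kernel_deriv :: "real poly \<Rightarrow> real poly" where
  "tanh_kernel_deriv p = pderiv p * [:1, 0, -1:] - [:0, 2:] * p"

lemma DERIV_tanh_kernel:
  "(tanh_kernel p has_real_derivative tanh_kernel (tanh_kernel_deriv p) y) (at y)"
  unfolding tanh_kernel_def[abs_def] tanh_kernel_deriv_def sech2_def
  by (auto intro!: derivative_eq_intros poly_DERIV[THEN DERIV_chain2] simp: algebra_simps power2_eq_square)

lemma isCont_tanh_kernel: "isCont (tanh_kernel p) y"
  using DERIV_tanh_kernel by (rule DERIV_isCont)

lemma borel_measurable_tanh_kernel [measurable]: "tanh_kernel p \<in> borel_measurable borel"
  by (intro borel_measurable_continuous_onI continuous_at_imp_continuous_on ballI isCont_tanh_kernel)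

lemma tanh_kernel_smult: "tanh_kernel (smult c p) y = c * tanh_kernel p y"
  by (simp add: tanh_kernel_def)

text \<open>\<open>tanh\<close> takes its values in the compact interval from -1 to 1, on which
  \<open>p\<close> is bounded.\<close>

lemma tanh_kernel_bound: "\<exists>C\<ge>0. \<forall>y. \<bar>tanh_kernel p y\<bar> \<le> C * sech2 y"
proof -
  have "bounded (poly p ` {-1..1})"
    by (intro compact_imp_bounded compact_continuous_image continuous_intros) auto
  then obtain C where C: "\<And>u. u \<in> {-1..1} \<Longrightarrow> \<bar>poly p u\<bar> \<le> C"
    by (force simp: bounded_iff)
  have "\<bar>tanh_kernel p y\<bar> \<le> C * sech2 y" for y
    using C[of "tanh y"] tanh_real_bounds[of y] sech2_pos[of y]
    by (auto simp: tanh_kernel_def abs_mult intro!: mult_right_mono)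
  moreover have "C \<ge> 0" using C[of 0] by force
  ultimately show ?thesis by blast
qed

lemma integrable_tanh_kernel: "integrable lborel (tanh_kernel p)"
proof -
  obtain C where C: "\<And>y. \<bar>tanh_kernel p y\<bar> \<le> C * sech2 y"
    using tanh_kernel_bound by blast
  show ?thesis
    by (rule Bochner_Integration.integrable_bound[where f = "\<lambda>y. C * sech2 y"])
      (use C in \<open>auto intro!: integrable_sech2 intro: order_trans[OF _ abs_ge_self]\<close>)
qed

subsection \<open>Functions of finitely many coordinates\<close>

text \<open>The update map is jointly continuous for the product topology, since each of its
  coordinates is a projection.\<close>

lemma tendsto_fun_upd:
  fixes x :: "'a \<Rightarrow> 'b::topological_space"
  assumes "(X \<longlongrightarrow> x) F" and "(a \<longlongrightarrow> b) F"
  shows "((\<lambda>l. (X l)(i := a l)) \<longlongrightarrow> x(i := b)) F"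
proof -
  have "continuous_on UNIV (\<lambda>p :: ('a \<Rightarrow> 'b) \<times> 'b. (fst p)(i := snd p))"
  proof (rule continuous_on_coordinatewise_then_product)
    fix j
    show "continuous_on UNIV (\<lambda>p :: ('a \<Rightarrow> 'b) \<times> 'b. ((fst p)(i := snd p)) j)"
      by (cases "j = i") (auto intro!: continuous_intros
        intro: continuous_on_product_then_coordinatewise[OF continuous_on_fst[OF continuous_on_id]])
  qed
  from continuous_on_tendsto_compose[OF this tendsto_Pair[OF assms]]
  show ?thesis by simp
qed

lemma tendsto_fun_apply:
  fixes x :: "'a \<Rightarrow> 'b::topological_space"
  assumes "(X \<longlongrightarrow> x) F"
  shows "((\<lambda>l. X l i) \<longlongrightarrow> x i) F"
  using continuous_on_tendsto_compose[OF continuous_on_product_coordinates assms] by simp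

lemma Cb_tendsto: "Cb n k f \<Longrightarrow> (X \<longlongrightarrow> x) F \<Longrightarrow> ((\<lambda>l. f (X l)) \<longlongrightarrow> f x) F"
  by (cases k) (auto intro: continuous_on_tendsto_compose[of UNIV f])

lemma Cb_bounded:
  assumes "Cb n k f"
  obtains C where "\<And>x. \<bar>f x\<bar> \<le> C"
  using assms by (cases k) (auto simp: bounded_iff)

lemma Cb_cong_first: "Cb n k f \<Longrightarrow> (\<And>i. i < n \<Longrightarrow> x i = y i) \<Longrightarrow> f x = f y"
  by (cases k) (auto simp: depends_on_first_def)

lemma borel_measurable_Cb_comp:
  assumes f: "Cb n k f" and X: "\<And>i. i < n \<Longrightarrow> X i \<in> borel_measurable M"
  shows "(\<lambda>\<omega>. f (\<lambda>i. X i \<omega>)) \<in> borel_measurable M"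
proof -
  \<comment> \<open>Measurability is known only for the first \<open>n\<close> coordinates. The
    others are set to 0, which \<open>f\<close> does not see.\<close>
  have "(\<lambda>\<omega> i. if i < n then X i \<omega> else 0) \<in> borel_measurable M"
  proof (rule measurable_coordinatewise_then_product)
    show "(\<lambda>\<omega>. if i < n then X i \<omega> else 0) \<in> borel_measurable M" for i
      using X[of i] by (cases "i < n") auto
  qed
  moreover have "f \<in> borel_measurable borel"
    using f by (cases k) (auto intro: borel_measurable_continuous_onI)
  ultimately have "(\<lambda>\<omega>. f (\<lambda>i. if i < n then X i \<omega> else 0)) \<in> borel_measurable M"
    by (rule measurable_compose)
  also have "(\<lambda>\<omega>. f (\<lambda>i. if i < n then X i \<omega> else 0)) = (\<lambda>\<omega>. f (\<lambda>i. X i \<omega>))"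
    by (intro ext Cb_cong_first[OF f]) auto
  finally show ?thesis .
qed

subsection \<open>Mollification\<close>

definition mollify :: "real \<Rightarrow> nat \<Rightarrow> real poly \<Rightarrow> ((nat \<Rightarrow> real) \<Rightarrow> real) \<Rightarrow> (nat \<Rightarrow> real) \<Rightarrow> real" where
  "mollify \<epsilon> i p f x = (LINT y|lborel. f (x(i := x i + \<epsilon> * y)) * tanh_kernel p y)"

lemma measurable_Cb_line:
  assumes "Cb n k f" "continuous_on UNIV g"
  shows "(\<lambda>y. f (x(i := g y))) \<in> borel_measurable borel"
proof (intro borel_measurable_continuous_onI)
  have "((\<lambda>y. f (x(i := g y))) \<longlongrightarrow> f (x(i := g y))) (at y)" for y
    using assms(2) by (intro Cb_tendsto[OF assms(1)] tendsto_fun_upd tendsto_const)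
      (auto simp: continuous_on_def)
  then show "continuous_on UNIV (\<lambda>y. f (x(i := g y)))"
    by (auto simp: continuous_on_def)
qed

lemma measurable_mollify [measurable]:
  assumes "Cb n k f"
  shows "(\<lambda>y. f (x(i := c + \<epsilon> * y)) * tanh_kernel p y) \<in> borel_measurable lborel"
  by (auto intro!: borel_measurable_times measurable_Cb_line[OF assms] continuous_intros)

lemma integrable_mollify:
  assumes f: "Cb n k f"
  shows "integrable lborel (\<lambda>y. f (x(i := c + \<epsilon> * y)) * tanh_kernel p y)"
proof -
  obtain C where C: "\<And>x. \<bar>f x\<bar> \<le> C" using Cb_bounded[OF f] by blast
  show ?thesis
  proof (rule Bochner_Integration.integrable_bound)
    show "integrable lborel (\<lambda>y. C * tanh_kernel p y)"
      using integrable_tanh_kernel by simp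
    show "AE y in lborel. norm (f (x(i := c + \<epsilon> * y)) * tanh_kernel p y) \<le> norm (C * tanh_kernel p y)"
      by (intro AE_I2) (auto simp: abs_mult intro!: mult_right_mono order_trans[OF C abs_ge_self])
  qed (rule measurable_mollify[OF f])
qed

lemma mollify_bound:
  assumes "\<And>x. \<bar>f x\<bar> \<le> C"
  shows "\<bar>mollify \<epsilon> i p f x\<bar> \<le> C * (LINT y|lborel. \<bar>tanh_kernel p y\<bar>)"
proof -
  have "\<bar>mollify \<epsilon> i p f x\<bar> \<le> (LINT y|lborel. \<bar>f (x(i := x i + \<epsilon> * y)) * tanh_kernel p y\<bar>)"
    unfolding mollify_def by (rule integral_abs_bound)
  also have "\<dots> \<le> (LINT y|lborel. C * \<bar>tanh_kernel p y\<bar>)"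
  proof (rule integral_mono')
    have "C \<ge> 0" using assms[of x] by simp
    then show "0 \<le> C * \<bar>tanh_kernel p y\<bar>" for y by simp
  qed (use assms integrable_tanh_kernel in \<open>auto simp: abs_mult intro!: mult_right_mono\<close>)
  finally show ?thesis by simp
qed

text \<open>Continuity is dominated convergence with majorant
  \<open>C * \<bar>tanh_kernel p y\<bar>\<close>; sequences suffice because the product topology on
  \<open>nat \<Rightarrow> real\<close> is first countable.\<close>

lemma Cb_mollify:
  assumes f: "Cb n 0 f"
  shows "Cb n 0 (mollify \<epsilon> i p f)"
proof -
  obtain C where C: "\<And>x. \<bar>f x\<bar> \<le> C" using Cb_bounded[OF f] by blast
  have "mollify \<epsilon> i p f x = mollify \<epsilon> i p f y" if "\<And>j. j < n \<Longrightarrow> x j = y j" for x y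
    unfolding mollify_def using that
    by (intro Bochner_Integration.integral_cong refl arg_cong2[where f = times] Cb_cong_first[OF f]) auto
  then have "depends_on_first n (mollify \<epsilon> i p f)"
    unfolding depends_on_first_def by blast
  moreover have "continuous_on UNIV (mollify \<epsilon> i p f)"
  proof (rule continuous_on_sequentiallyI)
    fix X :: "nat \<Rightarrow> nat \<Rightarrow> real" and x assume X: "X \<longlonglongrightarrow> x"
    show "(\<lambda>l. mollify \<epsilon> i p f (X l)) \<longlonglongrightarrow> mollify \<epsilon> i p f x"
      unfolding mollify_def
    proof (rule integral_dominated_convergence)
      show "integrable lborel (\<lambda>y. C * \<bar>tanh_kernel p y\<bar>)"
        using integrable_tanh_kernel by simp
      show "AE y in lborel. (\<lambda>l. f ((X l)(i := X l i + \<epsilon> * y)) * tanh_kernel p y)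
          \<longlonglongrightarrow> f (x(i := x i + \<epsilon> * y)) * tanh_kernel p y"
        by (intro AE_I2 tendsto_mult_right Cb_tendsto[OF f] tendsto_fun_upd[OF X]
            tendsto_add[OF tendsto_fun_apply[OF X] tendsto_const])
    qed (use C in \<open>auto simp: abs_mult intro!: mult_right_mono measurable_mollify[OF f, simplified]\<close>)
  qed
  moreover have "bounded (range (mollify \<epsilon> i p f))"
    unfolding bounded_iff using mollify_bound[of f, OF C] by (auto intro!: exI)
  ultimately show ?thesis by simp
qed

text \<open>The factor \<open>- 1 / \<epsilon>\<close> is the inner derivative of
  \<open>z - a / \<epsilon>\<close> with respect to \<open>a\<close>.\<close>

definition scaled_kernel_deriv :: "real \<Rightarrow> real poly \<Rightarrow> real poly" where
  "scaled_kernel_deriv \<epsilon> p = smult (- 1 / \<epsilon>) (tanh_kernel_deriv p)"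

text \<open>The derivative is again a mollification of the same \<open>f\<close>, only with another
  polynomial, so the step can be repeated to any order.\<close>

lemma DERIV_mollify_same:
  assumes f: "Cb n 0 f" and \<epsilon>: "\<epsilon> > 0"
  shows "((\<lambda>a. mollify \<epsilon> i p f (x(i := a))) has_real_derivative
          mollify \<epsilon> i (scaled_kernel_deriv \<epsilon> p) f x) (at (x i))"
proof -
  let ?p' = "scaled_kernel_deriv \<epsilon> p"
  \<comment> \<open>Moving the parameter into the kernel makes differentiability of \<open>f\<close> unnecessary.\<close>
  have shift: "mollify \<epsilon> i q f (x(i := a)) =
      (LINT z|lborel. f (x(i := 0 + \<epsilon> * z)) * tanh_kernel q (z - a / \<epsilon>))" for q a
  proof -
    have "(LINT z|lborel. f (x(i := 0 + \<epsilon> * z)) * tanh_kernel q (z - a / \<epsilon>)) =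
        \<bar>1\<bar> *\<^sub>R (LINT y|lborel. f (x(i := 0 + \<epsilon> * (a / \<epsilon> + 1 * y))) * tanh_kernel q (a / \<epsilon> + 1 * y - a / \<epsilon>))"
      by (rule lborel_integral_real_affine) simp
    then show ?thesis
      using \<epsilon> by (simp add: mollify_def distrib_left)
  qed
  obtain C where C: "\<And>x. \<bar>f x\<bar> \<le> C" using Cb_bounded[OF f] by blast
  then have "C \<ge> 0" by (meson abs_ge_zero order_trans)
  obtain K where K: "K \<ge> 0" "\<And>y. \<bar>tanh_kernel ?p' y\<bar> \<le> K * sech2 y"
    using tanh_kernel_bound by blast
  have "((\<lambda>a. LINT z|lborel. f (x(i := 0 + \<epsilon> * z)) * tanh_kernel p (z - a / \<epsilon>)) has_real_derivative
      (LINT z|lborel. f (x(i := 0 + \<epsilon> * z)) * tanh_kernel ?p' (z - x i / \<epsilon>))) (at (x i))"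
  proof (rule has_real_derivative_integral[where r = \<epsilon>])
    fix a z
    have [measurable]: "(\<lambda>z. f (x(i := 0 + \<epsilon> * z))) \<in> borel_measurable borel"
      by (intro measurable_Cb_line[OF f] continuous_intros)
    show "(\<lambda>z. f (x(i := 0 + \<epsilon> * z)) * tanh_kernel ?p' (z - x i / \<epsilon>)) \<in> borel_measurable lborel"
      by measurable
    show "integrable lborel (\<lambda>z. f (x(i := 0 + \<epsilon> * z)) * tanh_kernel p (z - a / \<epsilon>))"
    proof (rule Bochner_Integration.integrable_bound)
      show "integrable lborel (\<lambda>z. C * tanh_kernel p (- (a / \<epsilon>) + 1 * z))"
        by (intro integrable_mult_right lborel_integrable_real_affine integrable_tanh_kernel) simp
      show "AE z in lborel. norm (f (x(i := 0 + \<epsilon> * z)) * tanh_kernel p (z - a / \<epsilon>))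
          \<le> norm (C * tanh_kernel p (- (a / \<epsilon>) + 1 * z))"
        by (intro AE_I2) (auto simp: abs_mult intro!: mult_right_mono order_trans[OF C abs_ge_self])
    qed measurable
    have "((\<lambda>a. tanh_kernel p (z - a / \<epsilon>)) has_real_derivative
        tanh_kernel (tanh_kernel_deriv p) (z - a / \<epsilon>) * (- 1 / \<epsilon>)) (at a)"
      by (rule DERIV_chain2[OF DERIV_tanh_kernel]) (use \<epsilon> in \<open>auto intro!: derivative_eq_intros\<close>)
    then show "((\<lambda>a. f (x(i := 0 + \<epsilon> * z)) * tanh_kernel p (z - a / \<epsilon>)) has_real_derivative
        f (x(i := 0 + \<epsilon> * z)) * tanh_kernel ?p' (z - a / \<epsilon>)) (at a)"
      unfolding scaled_kernel_deriv_def tanh_kernel_smult by (auto intro!: derivative_eq_intros)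
    \<comment> \<open>For \<open>a\<close> within \<epsilon> of \<open>x i\<close> the kernel
      argument moves by at most 1, so \<open>sech2_shift\<close> costs the factor
      \<open>exp 2\<close>. This is why the radius is \<epsilon>.\<close>
    show "integrable lborel (\<lambda>z. C * (K * (exp 2 * sech2 (- (x i / \<epsilon>) + 1 * z))))"
      by (intro integrable_mult_right lborel_integrable_real_affine integrable_sech2) simp
    assume "\<bar>a - x i\<bar> < \<epsilon>"
    then have "\<bar>(x i - a) / \<epsilon>\<bar> \<le> 1" using \<epsilon> by (simp add: abs_minus_commute)
    have "sech2 (z - a / \<epsilon>) = sech2 (z - x i / \<epsilon> + (x i - a) / \<epsilon>)"
      by (simp add: diff_divide_distrib)
    also have "\<dots> \<le> exp (2 * \<bar>(x i - a) / \<epsilon>\<bar>) * sech2 (z - x i / \<epsilon>)"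
      by (rule sech2_shift)
    also have "\<dots> \<le> exp 2 * sech2 (z - x i / \<epsilon>)"
      using \<open>\<bar>(x i - a) / \<epsilon>\<bar> \<le> 1\<close> sech2_pos[of "z - x i / \<epsilon>"] by (intro mult_right_mono) auto
    finally have "K * sech2 (z - a / \<epsilon>) \<le> K * (exp 2 * sech2 (z - x i / \<epsilon>))"
      using K(1) by (rule mult_left_mono)
    then have "\<bar>tanh_kernel ?p' (z - a / \<epsilon>)\<bar> \<le> K * (exp 2 * sech2 (z - x i / \<epsilon>))"
      using K(2) order_trans by blast
    then show "\<bar>f (x(i := 0 + \<epsilon> * z)) * tanh_kernel ?p' (z - a / \<epsilon>)\<bar>
        \<le> C * (K * (exp 2 * sech2 (- (x i / \<epsilon>) + 1 * z)))"
      unfolding abs_mult using C \<open>C \<ge> 0\<close> by (intro mult_mono) auto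
  qed (use \<epsilon> in simp)
  moreover have "(LINT z|lborel. f (x(i := 0 + \<epsilon> * z)) * tanh_kernel ?p' (z - x i / \<epsilon>)) = mollify \<epsilon> i ?p' f x"
    using shift[of ?p' "x i"] by simp
  ultimately show ?thesis
    unfolding shift by (simp only:)
qed

text \<open>Here the derivative falls on \<open>f\<close>. The case \<open>j = i\<close> is
  included: the added \<open>\<epsilon> * y\<close> is a translation, with inner derivative
  1.\<close>

lemma DERIV_mollify:
  assumes f: "Cb n k f" and f': "Cb n k' f'"
    and deriv: "\<And>x. ((\<lambda>a. f (x(j := a))) has_real_derivative f' x) (at (x j))"
  shows "((\<lambda>a. mollify \<epsilon> i p f (x(j := a))) has_real_derivative mollify \<epsilon> i p f' x) (at (x j))"
proof -
  obtain C where C: "\<And>x. \<bar>f' x\<bar> \<le> C" using Cb_bounded[OF f'] by blast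
  define z where "z a y = (x(j := a))(i := (x(j := a)) i + \<epsilon> * y)" for a y
  have "((\<lambda>a. LINT y|lborel. f (z a y) * tanh_kernel p y) has_real_derivative
      (LINT y|lborel. f' (z (x j) y) * tanh_kernel p y)) (at (x j))"
  proof (rule has_real_derivative_integral[where r = 1])
    fix a y
    show "integrable lborel (\<lambda>y. f (z a y) * tanh_kernel p y)"
      unfolding z_def by (rule integrable_mollify[OF f])
    show "(\<lambda>y. f' (z (x j) y) * tanh_kernel p y) \<in> borel_measurable lborel"
      unfolding z_def by (rule measurable_mollify[OF f'])
    show "integrable lborel (\<lambda>y. C * \<bar>tanh_kernel p y\<bar>)"
      using integrable_tanh_kernel by simp
    show "\<bar>f' (z a y) * tanh_kernel p y\<bar> \<le> C * \<bar>tanh_kernel p y\<bar>"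
      using C by (auto simp: abs_mult intro!: mult_right_mono)
    \<comment> \<open>The displacement of coordinate \<open>j\<close> caused by the mollification,
      which is present only if \<open>j\<close> is the mollified coordinate.\<close>
    define c where "c = (if j = i then \<epsilon> * y else 0)"
    have line: "z b y = (z a y)(j := b + c)" for b
      unfolding z_def c_def by (cases "j = i") (simp_all add: fun_eq_iff)
    have "((\<lambda>b. f ((z a y)(j := b + c))) has_real_derivative f' (z a y)) (at a)"
    proof -
      have "z a y j = a + c" by (simp add: z_def c_def)
      then have "((\<lambda>b. f ((z a y)(j := b))) has_real_derivative f' (z a y)) (at (a + c))"
        using deriv[of "z a y"] by simp
      then show ?thesis by (simp only: DERIV_shift)
    qed
    from DERIV_cmult_right[OF this]
    show "((\<lambda>a. f (z a y) * tanh_kernel p y) has_real_derivative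
        f' (z a y) * tanh_kernel p y) (at a)"
      unfolding line[symmetric] .
  qed auto
  then show ?thesis
    unfolding z_def mollify_def fun_upd_triv .
qed

section \<open>Mollification in several coordinates\<close>

text \<open>Coordinate 0 is the innermost layer. Each coordinate has its own polynomial because a
  partial derivative alters just one of the kernels.\<close>

primrec mollify_first ::
    "real \<Rightarrow> (nat \<Rightarrow> real poly) \<Rightarrow> nat \<Rightarrow> ((nat \<Rightarrow> real) \<Rightarrow> real) \<Rightarrow> (nat \<Rightarrow> real) \<Rightarrow> real" where
  "mollify_first \<epsilon> P 0 f = f"
| "mollify_first \<epsilon> P (Suc m) f = mollify \<epsilon> m (P m) (mollify_first \<epsilon> P m f)"

lemma mollify_first_cong:
  "(\<And>i. i < m \<Longrightarrow> P i = Q i) \<Longrightarrow> mollify_first \<epsilon> P m f = mollify_first \<epsilon> Q m f"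
  by (induction m) auto

lemma Cb_mollify_first: "Cb n 0 f \<Longrightarrow> Cb n 0 (mollify_first \<epsilon> P m f)"
  by (induction m) (simp_all only: mollify_first.simps Cb_mollify)

text \<open>Each layer multiplies the bound by the L1 norm of its kernel, in which \<epsilon> does
  not occur. The uniformity in \<epsilon> serves dominated convergence as \<epsilon> tends to
  0.\<close>

lemma mollify_first_bound:
  assumes "Cb n k f"
  shows "\<exists>C. \<forall>\<epsilon> x. \<bar>mollify_first \<epsilon> P m f x\<bar> \<le> C"
proof (induction m)
  case 0
  obtain C where "\<And>x. \<bar>f x\<bar> \<le> C" using Cb_bounded[OF assms] by blast
  then show ?case by auto
next
  case (Suc m)
  then obtain C where "\<And>\<epsilon> x. \<bar>mollify_first \<epsilon> P m f x\<bar> \<le> C" by blast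
  then have "\<forall>\<epsilon> x. \<bar>mollify_first \<epsilon> P (Suc m) f x\<bar> \<le> C * (LINT y|lborel. \<bar>tanh_kernel (P m) y\<bar>)"
    unfolding mollify_first.simps by (intro allI mollify_bound)
  then show ?case ..
qed

text \<open>Layer \<open>i\<close> takes the derivative into its kernel by
  \<open>DERIV_mollify_same\<close>, where the inner layers need only be continuous and bounded; the
  layers outside it pass the derivative inwards by \<open>DERIV_mollify\<close>.\<close>

lemma DERIV_mollify_first_same:
  assumes f: "Cb n 0 f" and "\<epsilon> > 0" and "i < m"
  shows "((\<lambda>a. mollify_first \<epsilon> P m f (x(i := a))) has_real_derivative
          mollify_first \<epsilon> (P(i := scaled_kernel_deriv \<epsilon> (P i))) m f x) (at (x i))"
  using \<open>i < m\<close>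
proof (induction m arbitrary: x)
  case (Suc m)
  let ?Q = "P(i := scaled_kernel_deriv \<epsilon> (P i))"
  show ?case
  proof (cases "i = m")
    case True
    \<comment> \<open>The layers below \<open>m\<close> use only polynomials with index below
      \<open>m\<close>, so the update at \<open>m\<close> does not reach them.\<close>
    then have "mollify_first \<epsilon> ?Q m f = mollify_first \<epsilon> P m f"
      by (intro mollify_first_cong) auto
    then show ?thesis
      using DERIV_mollify_same[OF Cb_mollify_first[OF f] \<open>\<epsilon> > 0\<close>]
      unfolding True mollify_first.simps fun_upd_same by (simp only:)
  next
    case False
    then have "i < m" and Q: "?Q m = P m" using Suc.prems by auto
    then show ?thesis
      unfolding mollify_first.simps Q
      by (intro DERIV_mollify[OF Cb_mollify_first[OF f] Cb_mollify_first[OF f]] Suc.IH)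
  qed
qed simp

text \<open>Complement to \<open>DERIV_mollify_first_same\<close>: if \<open>f\<close> is
  differentiable, the derivative passes through all layers, so the derivatives of the mollification
  approximate those of \<open>f\<close>.\<close>

lemma DERIV_mollify_first:
  assumes f: "Cb n 0 f" and f': "Cb n 0 f'"
    and deriv: "\<And>x. ((\<lambda>a. f (x(j := a))) has_real_derivative f' x) (at (x j))"
  shows "((\<lambda>a. mollify_first \<epsilon> P m f (x(j := a))) has_real_derivative mollify_first \<epsilon> P m f' x) (at (x j))"
proof (induction m arbitrary: x)
  case 0
  show ?case unfolding mollify_first.simps by (rule deriv)
next
  case (Suc m)
  show ?case
    unfolding mollify_first.simps
    by (rule DERIV_mollify[OF Cb_mollify_first[OF f] Cb_mollify_first[OF f'] Suc.IH])
qed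

text \<open>All \<open>n\<close> coordinates are mollified, so every partial derivative is a
  mollification of \<open>f\<close> with one polynomial changed. The induction on the order
  therefore runs over all \<open>P\<close>.\<close>

lemma Cb_infinity_mollify_first:
  assumes f: "Cb n 0 f" and "\<epsilon> > 0"
  shows "Cb_infinity n (mollify_first \<epsilon> P n f)"
proof -
  have "Cb n k (mollify_first \<epsilon> P n f)" for k
  proof (induction k arbitrary: P)
    case 0
    show ?case by (rule Cb_mollify_first[OF f])
  next
    case (Suc k)
    have "partial_deriv i (mollify_first \<epsilon> P n f) =
        mollify_first \<epsilon> (P(i := scaled_kernel_deriv \<epsilon> (P i))) n f"
      and "(\<lambda>a. mollify_first \<epsilon> P n f (x(i := a))) differentiable at (x i)" if "i < n" for i x
    proof -
      note D = DERIV_mollify_first_same[OF assms that, of P]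
      show "partial_deriv i (mollify_first \<epsilon> P n f) =
          mollify_first \<epsilon> (P(i := scaled_kernel_deriv \<epsilon> (P i))) n f"
        unfolding partial_deriv_def by (intro ext DERIV_imp_deriv D)
      show "(\<lambda>a. mollify_first \<epsilon> P n f (x(i := a))) differentiable at (x i)"
        using D unfolding real_differentiable_def by (rule exI)
    qed
    then show ?case
      using Suc Cb_mollify_first[OF f] unfolding Cb.simps(2) by simp
  qed
  then show ?thesis by (simp add: Cb_infinity_def)
qed

text \<open>The points \<open>X l\<close> vary because the induction step shifts the argument of the inner mollification
  by an amount that depends on \<open>\<epsilon> l\<close>.\<close>

lemma mollify_first_tendsto:
  assumes f: "Cb n 0 f" and \<epsilon>: "\<epsilon> \<longlonglongrightarrow> 0" and X: "X \<longlonglongrightarrow> x"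
  shows "(\<lambda>l. mollify_first (\<epsilon> l) (\<lambda>_. [:1/2:]) m f (X l)) \<longlonglongrightarrow> f x"
  using X
proof (induction m arbitrary: X)
  case 0
  then show ?case using Cb_tendsto[OF f] by simp
next
  case (Suc m)
  \<comment> \<open>Half of \<open>sech2\<close> has integral 1, so the limit integral equals
    \<open>f x\<close>.\<close>
  let ?P = "\<lambda>_. [:1/2 :: real:]"
  obtain C where C: "\<And>\<epsilon> x. \<bar>mollify_first \<epsilon> ?P m f x\<bar> \<le> C"
    using mollify_first_bound[OF f] by blast
  have "(\<lambda>l. mollify_first (\<epsilon> l) ?P (Suc m) f (X l)) \<longlonglongrightarrow> (LINT y|lborel. f x * tanh_kernel [:1/2:] y)"
    unfolding mollify_first.simps mollify_def
  proof (rule integral_dominated_convergence)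
    show "integrable lborel (\<lambda>y. C * \<bar>tanh_kernel [:1/2:] y\<bar>)"
      using integrable_tanh_kernel by simp
    show "AE y in lborel. (\<lambda>l. mollify_first (\<epsilon> l) ?P m f ((X l)(m := X l m + \<epsilon> l * y)) * tanh_kernel [:1/2:] y)
        \<longlonglongrightarrow> f x * tanh_kernel [:1/2:] y"
    proof (intro AE_I2 tendsto_mult_right)
      fix y
      have "(\<lambda>l. (X l)(m := X l m + \<epsilon> l * y)) \<longlonglongrightarrow> x(m := x m + 0 * y)"
        by (rule tendsto_fun_upd[OF Suc.prems tendsto_add[OF tendsto_fun_apply[OF Suc.prems]
            tendsto_mult_right[OF \<epsilon>]]])
      then show "(\<lambda>l. mollify_first (\<epsilon> l) ?P m f ((X l)(m := X l m + \<epsilon> l * y))) \<longlonglongrightarrow> f x"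
        by (intro Suc.IH) (simp only: mult_zero_left add_0_right fun_upd_triv)
    qed
  qed (use C in \<open>auto simp: abs_mult intro!: mult_right_mono
        measurable_mollify[OF Cb_mollify_first[OF f], simplified]\<close>)
  also have "(LINT y|lborel. f x * tanh_kernel [:1/2:] y) = f x"
    by (simp add: tanh_kernel_def integral_sech2)
  finally show ?case .
qed

section \<open>Smooth approximation together with first derivatives\<close>

text \<open>Both derivative formulas for the iterated mollification are used: the one acting on the
  kernels gives smoothness, the one acting on \<open>f\<close> gives convergence and bounds of the
  partial derivatives.\<close>

lemma Cb_approximation:
  assumes f: "Cb n (Suc 0) f"
  obtains g :: "nat \<Rightarrow> (nat \<Rightarrow> real) \<Rightarrow> real" and C
  where "\<And>l. Cb_infinity n (g l)"
    and "\<And>x. (\<lambda>l. g l x) \<longlonglongrightarrow> f x"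
    and "\<And>i x. i < n \<Longrightarrow> (\<lambda>l. partial_deriv i (g l) x) \<longlonglongrightarrow> partial_deriv i f x"
    and "\<And>l x. \<bar>g l x\<bar> \<le> C"
    and "\<And>i l x. i < n \<Longrightarrow> \<bar>partial_deriv i (g l) x\<bar> \<le> C"
proof -
  let ?P = "\<lambda>_. [:1/2 :: real:]"
  define \<epsilon> :: "nat \<Rightarrow> real" where "\<epsilon> l = inverse (real (Suc l))" for l
  have \<epsilon>: "\<epsilon> \<longlonglongrightarrow> 0" "\<And>l. \<epsilon> l > 0"
    unfolding \<epsilon>_def by (rule LIMSEQ_inverse_real_of_nat) simp
  define g where "g l = mollify_first (\<epsilon> l) ?P n f" for l
  have f0: "Cb n 0 f" and f': "\<And>i. i < n \<Longrightarrow> Cb n 0 (partial_deriv i f)"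
    using f unfolding Cb.simps(2) by blast+
  have deriv: "((\<lambda>a. f (x(i := a))) has_real_derivative partial_deriv i f x) (at (x i))" if "i < n" for i x
    using f that unfolding Cb.simps(2) partial_deriv_def DERIV_deriv_iff_real_differentiable by blast
  have g': "partial_deriv i (g l) = mollify_first (\<epsilon> l) ?P n (partial_deriv i f)" if "i < n" for i l
    using DERIV_mollify_first[OF f0 f'[OF that] deriv[OF that]]
    unfolding g_def partial_deriv_def[of i "mollify_first _ _ _ _"] by (intro ext DERIV_imp_deriv)
  obtain C where C: "\<And>l x. \<bar>g l x\<bar> \<le> C"
    unfolding g_def using mollify_first_bound[OF f0] by meson
  have "\<forall>i. \<exists>C. i < n \<longrightarrow> (\<forall>l x. \<bar>partial_deriv i (g l) x\<bar> \<le> C)"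
    using mollify_first_bound[OF f'] g' by metis
  then have "\<exists>C'. \<forall>i. i < n \<longrightarrow> (\<forall>l x. \<bar>partial_deriv i (g l) x\<bar> \<le> C' i)"
    by (rule choice)
  then obtain C' where C': "\<And>i l x. i < n \<Longrightarrow> \<bar>partial_deriv i (g l) x\<bar> \<le> C' i"
    by blast
  show ?thesis
  proof
    show "Cb_infinity n (g l)" for l
      unfolding g_def using f0 \<epsilon>(2) by (rule Cb_infinity_mollify_first)
    show "(\<lambda>l. g l x) \<longlonglongrightarrow> f x" for x
      unfolding g_def by (rule mollify_first_tendsto[OF f0 \<epsilon>(1)]) simp
    show "(\<lambda>l. partial_deriv i (g l) x) \<longlonglongrightarrow> partial_deriv i f x" if "i < n" for i x
      unfolding g'[OF that] by (rule mollify_first_tendsto[OF f'[OF that] \<epsilon>(1)]) simp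
    \<comment> \<open>The bounds \<open>C' i\<close> depend on the coordinate; the sum over finitely
      many of them yields a common constant.\<close>
    let ?C = "\<bar>C\<bar> + (\<Sum>i<n. \<bar>C' i\<bar>)"
    show "\<bar>g l x\<bar> \<le> ?C" for l x
      by (rule order_trans[OF C]) (simp add: add_increasing2 sum_nonneg)
    show "\<bar>partial_deriv i (g l) x\<bar> \<le> ?C" if "i < n" for i l x
      using C'[OF that, of l x] member_le_sum[of i "{..<n}" "\<lambda>i. \<bar>C' i\<bar>"] that by force
  qed
qed

subsection \<open>Passage to the limit\<close>

lemma borel_measurable_fractional_brownian_motion:
  assumes "fractional_brownian_motion M H T B" and "t \<in> {0..T}"
  shows "B t \<in> borel_measurable M"
proof -
  \<comment> \<open>Measurability of a single \<open>B t\<close> is read off from the one-term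
    linear combination with coefficient 1.\<close>
  have "gaussian_rv M (\<lambda>\<omega>. \<Sum>s\<in>{t}. 1 * B s \<omega>)"
    using assms unfolding fractional_brownian_motion_def gaussian_process_def
    by (elim conjE allE[of _ "{t}"] allE[of _ "\<lambda>_. 1"]) auto
  then show ?thesis by (simp add: gaussian_rv_def)
qed

lemma L2_bounded:
  fixes X :: "'w \<Rightarrow> 'b::{banach, second_countable_topology}"
  assumes "prob_space M" and "X \<in> borel_measurable M" and "\<And>\<omega>. norm (X \<omega>) \<le> C"
  shows "X \<in> L2 M"
proof -
  interpret prob_space M by fact
  have "integrable M (\<lambda>\<omega>. (norm (X \<omega>))\<^sup>2)"
  proof (rule integrable_const_bound[where B = "C\<^sup>2"])
    show "AE \<omega> in M. norm ((norm (X \<omega>))\<^sup>2) \<le> C\<^sup>2"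
      using assms(3) by (auto intro!: power_mono)
  qed (use assms(2) in measurable)
  with assms(2) show ?thesis by (simp add: L2_def)
qed

lemma integrable_norm_L2:
  fixes X :: "'w \<Rightarrow> 'b::{banach, second_countable_topology}"
  assumes "prob_space M" and "X \<in> L2 M"
  shows "integrable M (\<lambda>\<omega>. norm (X \<omega>))"
proof -
  interpret prob_space M by fact
  show ?thesis
  proof (rule Bochner_Integration.integrable_bound)
    show "integrable M (\<lambda>\<omega>. 1 + (norm (X \<omega>))\<^sup>2)"
      using assms(2) by (simp add: L2_def)
    \<comment> \<open>Expanding the square of r - 1/2 gives even the constant 1/4; the constant 1 is
      integrable because the measure is finite.\<close>
    have "r \<le> 1 + r\<^sup>2" for r :: real
      using zero_le_power2[of "r - 1 / 2"] by (simp add: power2_eq_square algebra_simps)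
    then show "AE \<omega> in M. norm (norm (X \<omega>)) \<le> norm (1 + (norm (X \<omega>))\<^sup>2)" by simp
  qed (use assms(2) in \<open>auto simp: L2_def\<close>)
qed

theorem theorem6p1:
  fixes M :: "'w measure"
    and H T :: real
    and B :: "real \<Rightarrow> 'w \<Rightarrow> real"
    and val :: "'h::{real_inner,banach,second_countable_topology} \<Rightarrow> real \<Rightarrow> real"
    and k :: "real \<Rightarrow> 'h"
    and n :: nat
    and t :: "nat \<Rightarrow> real"
    and f :: "(nat \<Rightarrow> real) \<Rightarrow> real"
  assumes "prob_space M" and "complete_measure M"
    and "T > 0" and "0 < H" and "H < 1/2"
    and "fractional_brownian_motion M H T B"
    and "is_rkhs {0..T} (fbm_cov H) val k"
    and "\<forall>i<n. t i \<in> {0..T}" and "strict_mono_on {..<n} t"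
    and "Cb n 1 f"
  shows "has_op_cov_deriv M T B k
           (\<lambda>\<omega>. f (\<lambda>i. B (t i) \<omega>))
           (\<lambda>\<omega>. \<Sum>i<n. partial_deriv i f (\<lambda>j. B (t j) \<omega>) *\<^sub>R k (t i))"
proof -
  have f: "Cb n (Suc 0) f" using \<open>Cb n 1 f\<close> by simp
  then have f': "Cb n 0 (partial_deriv i f)" if "i < n" for i
    using that unfolding Cb.simps(2) by blast
  have B: "B (t i) \<in> borel_measurable M" if "i < n" for i
    using that assms borel_measurable_fractional_brownian_motion by blast
  note meas = borel_measurable_Cb_comp[OF _ B]
  obtain g :: "nat \<Rightarrow> (nat \<Rightarrow> real) \<Rightarrow> real" and C
    where g: "\<And>l. Cb_infinity n (g l)"
      and g_lim: "\<And>x. (\<lambda>l. g l x) \<longlonglongrightarrow> f x"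
      and g'_lim: "\<And>i x. i < n \<Longrightarrow> (\<lambda>l. partial_deriv i (g l) x) \<longlonglongrightarrow> partial_deriv i f x"
      and g_bound: "\<And>l x. \<bar>g l x\<bar> \<le> C"
      and g'_bound: "\<And>i l x. i < n \<Longrightarrow> \<bar>partial_deriv i (g l) x\<bar> \<le> C"
    using Cb_approximation[OF f] by metis
  have g1: "Cb n (Suc 0) (g l)" for l
    using g unfolding Cb_infinity_def by blast
  then have g': "Cb n 0 (partial_deriv i (g l))" if "i < n" for i l
    using that unfolding Cb.simps(2) by blast
  let ?F = "\<lambda>\<omega>. f (\<lambda>i. B (t i) \<omega>)"
  \<comment> \<open>The claimed derivative is the formula for the Malliavin derivative, applied to
    an \<open>f\<close> that need not be smooth.\<close>
  let ?D = "malliavin_deriv B k n t"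
  have D_eq: "?D h = (\<lambda>\<omega>. \<Sum>i<n. partial_deriv i h (\<lambda>j. B (t j) \<omega>) *\<^sub>R k (t i))" for h
    by (simp add: fun_eq_iff malliavin_deriv_def cylindrical_def)
  let ?K = "C * (\<Sum>i<n. norm (k (t i)))"
  have D_bound: "norm (?D h \<omega>) \<le> ?K" if "\<And>i x. i < n \<Longrightarrow> \<bar>partial_deriv i h x\<bar> \<le> C" for h \<omega>
    unfolding D_eq sum_distrib_left by (intro sum_norm_le) (auto simp: that intro!: mult_right_mono)
  have D_meas: "?D h \<in> borel_measurable M" if "\<And>i. i < n \<Longrightarrow> Cb n 0 (partial_deriv i h)" for h
    unfolding D_eq using that by (intro borel_measurable_sum borel_measurable_scaleR meas) (auto simp del: Cb.simps)
  \<comment> \<open>The uniform bounds survive the pointwise limit; they put \<open>?F\<close> and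
    \<open>?D f\<close> into \<open>L2 M\<close>.\<close>
  have f_bound: "\<bar>f x\<bar> \<le> C" for x
    using g_lim g_bound by (intro tendsto_upperbound[OF tendsto_rabs[OF g_lim]]) auto
  have f'_bound: "\<bar>partial_deriv i f x\<bar> \<le> C" if "i < n" for i x
    using g'_bound that by (intro tendsto_upperbound[OF tendsto_rabs[OF g'_lim]]) auto
  \<comment> \<open>Both sides are limits of the same sequence: directly on the left, and after
    rewriting by adjointness for the smooth \<open>g l\<close> on the right. The majorants are
    multiples of \<open>norm (V \<omega>)\<close> and \<open>norm (u \<omega>)\<close>.\<close>
  have "(LINT \<omega>|M. ?F \<omega> * V \<omega>) = (LINT \<omega>|M. inner (?D f \<omega>) (u \<omega>))"
    if "has_skorokhod_integral M T B k u V" for u V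
  proof (rule LIMSEQ_unique)
    have u: "u \<in> L2 M" and V: "V \<in> L2 M"
      and adjoint: "\<And>l. (LINT \<omega>|M. g l (\<lambda>i. B (t i) \<omega>) * V \<omega>) = (LINT \<omega>|M. inner (?D (g l) \<omega>) (u \<omega>))"
      using that g assms(8) unfolding has_skorokhod_integral_def cylindrical_def by blast+
    have [measurable]: "u \<in> borel_measurable M" "V \<in> borel_measurable M"
      using u V by (simp_all add: L2_def)
    note [measurable] = meas[OF f] meas[OF g1] D_meas[OF f'] D_meas[OF g']
    show "(\<lambda>l. LINT \<omega>|M. g l (\<lambda>i. B (t i) \<omega>) * V \<omega>) \<longlonglongrightarrow> (LINT \<omega>|M. ?F \<omega> * V \<omega>)"
    proof (rule integral_dominated_convergence)
      show "integrable M (\<lambda>\<omega>. C * norm (V \<omega>))"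
        using integrable_norm_L2[OF assms(1) V] by simp
      show "AE \<omega> in M. (\<lambda>l. g l (\<lambda>i. B (t i) \<omega>) * V \<omega>) \<longlonglongrightarrow> ?F \<omega> * V \<omega>"
        by (intro AE_I2 tendsto_mult_right g_lim)
      show "AE \<omega> in M. norm (g l (\<lambda>i. B (t i) \<omega>) * V \<omega>) \<le> C * norm (V \<omega>)" for l
        using g_bound by (auto simp: abs_mult intro!: mult_right_mono)
    qed measurable
    show "(\<lambda>l. LINT \<omega>|M. g l (\<lambda>i. B (t i) \<omega>) * V \<omega>) \<longlonglongrightarrow> (LINT \<omega>|M. inner (?D f \<omega>) (u \<omega>))"
      unfolding adjoint
    proof (rule integral_dominated_convergence)
      show "integrable M (\<lambda>\<omega>. ?K * norm (u \<omega>))"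
        using integrable_norm_L2[OF assms(1) u] by simp
      show "AE \<omega> in M. (\<lambda>l. inner (?D (g l) \<omega>) (u \<omega>)) \<longlonglongrightarrow> inner (?D f \<omega>) (u \<omega>)"
        unfolding D_eq by (intro AE_I2 tendsto_intros g'_lim) auto
      show "AE \<omega> in M. norm (inner (?D (g l) \<omega>) (u \<omega>)) \<le> ?K * norm (u \<omega>)" for l
        unfolding real_norm_def
        by (intro AE_I2 order_trans[OF Cauchy_Schwarz_ineq2] mult_right_mono D_bound g'_bound) auto
    qed measurable
  qed
  moreover have "?F \<in> L2 M"
    by (rule L2_bounded[OF assms(1) meas[OF f]]) (use f_bound in auto)
  moreover have "?D f \<in> L2 M"
    by (rule L2_bounded[OF assms(1) D_meas[OF f']]) (use D_bound[of f] f'_bound in auto)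
  ultimately show ?thesis
    unfolding has_op_cov_deriv_def D_eq by blast
qed

end
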